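(* Let $M$ be a reduced totally-ordered torsion-free monoid (written additively), and let $R$ be an integral domain. Let $n \in \mathbb{N}$ and suppose that the element $$f = \alpha_n X^{q_n} + \dots + \alpha_1 X^{q_1} + \alpha_0 \in R[M] \setminus \{0\},$$ written in canonical form (that is, $\alpha_0,\dots,\alpha_n \in R$ are all nonzero and $q_n > \dots > q_1 > 0$ in $M$), is primitive. If there exists a prime ideal $P$ of $R$ satisfying the conditions (1) $\alpha_n \notin P$, (2) $\alpha_j \in P$ for every integer $j$ with $0 \le j \le n-1$, and (3) $\alpha_0 \notin P^2$, then $f$ is irreducible in $R[M]$.
   Context: $\mathbb{N} = \{1,2,\dots\}$. A monoid is a commutative and cancellative semigroup with an identity element. It is reduced if its only invertible element is the identity, and torsion-free if (in additive notation) $nx = ny$ with $x,y \in M$ and $n \in \mathbb{N}$ implies $x=y$. A totally-ordered monoid is a monoid equipped with a total order compatible with its operation. For an integral domain $R$ and a reduced torsion-free monoid $M$ written additively, the monoid ring $R[M]$ is the set of all maps $f\colon M \to R$ with finite support, written as polynomial expressions $f = \sum_{s \in M} f(s) X^s$, with addition and multiplication as for polynomials (so $X^s X^t = X^{s+t}$). It is an integral domain with group of units $R^\times$; $R$ is identified with the subring of constants $rX^0$. An element $r \in R$ is a greatest common divisor of $r_1,\dots,r_k \in R\setminus\{0\}$ if $r$ divides every $r_i$ in $R$ and $r$ is divisible by each common divisor of $r_1,\dots,r_k$; $\mathrm{GCD}(r_1,\dots,r_k)$ is the (possibly empty) set of all greatest common divisors of $r_1,\dots,r_k$. For $f \in R[M]\setminus\{0\}$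 with nonzero coefficients $\alpha_1,\dots,\alpha_k$ (at pairwise distinct exponents), the content of $f$ is $\mathsf{c}(f) := \mathrm{GCD}(\alpha_1,\dots,\alpha_k)$, and $f$ is called primitive if $\mathsf{c}(f) = R^\times$. *)

theory Defs
  imports "HOL-Library.Poly_Mapping" "HOL-Algebra.Algebraic_Closure_Type"
    "HOL-Algebra.Ideal_Product"
begin

(* The library's cancel_comm_monoid_add would additionally demand a total subtraction operation
   subject to laws; cancel_semigroup_add asks for cancellation only. *)
class totally_ordered_monoid = comm_monoid_add + cancel_semigroup_add + linordered_ab_semigroup_add

(* All greatest common divisors, determined only up to associates; possibly the empty set. *)
definition gcds :: "'r::idom set \<Rightarrow> 'r set" where
  "gcds A = {r. (\<forall>a\<in>A. r dvd a) \<and> (\<forall>d. (\<forall>a\<in>A. d dvd a) \<longrightarrow> d dvd r)}"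

(* The type of finitely supported functions from 'm to 'r, with its convolution product, is the
   monoid ring R[M]; Poly_Mapping.single s r is the term r X^s. *)
definition content :: "('m \<Rightarrow>\<^sub>0 'r::idom) \<Rightarrow> 'r set" where
  "content f = gcds (Poly_Mapping.lookup f ` Poly_Mapping.keys f)"

definition primitive :: "('m \<Rightarrow>\<^sub>0 'r::idom) \<Rightarrow> bool" where
  "primitive f \<longleftrightarrow> content f = {u. u dvd 1}"

end

theory Submission
  imports Defs
begin

text \<open>
  Reduce coefficients modulo \<open>P\<close>. A product of two nonzero elements of \<open>(R/P)[M]\<close> has a nonzero coefficient
  at the sum of the two least exponents and at the sum of the two greatest ones, because \<open>R/P\<close> is
  a domain and \<open>M\<close> is ordered and cancellative. The same holds over \<open>R\<close>, which is the case of the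
  prime ideal \<open>{0}\<close>. Instead of passing to the quotient, the exponents whose coefficient lies outside
  \<open>P\<close> are collected in \<open>supp_mod P\<close>; the two facts are \<open>Min_supp_mod_mult\<close> and
  \<open>Max_supp_mod_mult\<close>.

  Let \<open>f = g * h\<close>. The order on \<open>M\<close> need not make all elements nonnegative, so \<open>g\<close> and \<open>h\<close> might
  a priori have negative exponents. They do not: the least exponents of \<open>g\<close> and \<open>h\<close> add up to that of
  \<open>f\<close>, which is \<open>0\<close>, and \<open>M\<close> is reduced, so both are \<open>0\<close>. In particular \<open>\<alpha>\<^sub>0\<close> is the product of
  the two constant coefficients, and as \<open>\<alpha>\<^sub>0 \<notin> P\<^sup>2\<close> one of these, say that of \<open>g\<close>, lies outside \<open>P\<close>.

  Modulo \<open>P\<close> only the leading term of \<open>f\<close> survives. As \<open>g\<close> has least exponent \<open>0\<close> modulo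
  \<open>P\<close>, the least exponent of \<open>h\<close> modulo \<open>P\<close> is \<open>q\<^sub>n\<close>. Thus \<open>h\<close> already uses up the whole degree of
  \<open>f\<close>, and \<open>g\<close> is a constant (\<open>keys_eq_zero_if_constant_coeff_notin\<close>). A constant dividing the
  primitive element \<open>f\<close> is a unit.
\<close>

section \<open>Prime ideals of a type-class ring\<close>

abbreviation (input) prime_ideal :: "'r::idom set \<Rightarrow> bool" where
  "prime_ideal P \<equiv> primeideal P (ring_of_type_algebra :: 'r ring)"

context
  fixes P :: "'r::idom set"
  assumes P: "prime_ideal P"
begin

interpretation primeideal P "ring_of_type_algebra :: 'r ring"
  by (rule P)

lemma prime_ideal_zero: "0 \<in> P"
  using additive_subgroup.zero_closed[OF is_additive_subgroup]
  by (simp add: ring_of_type_algebra_def)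

lemma prime_ideal_add: "x \<in> P \<Longrightarrow> y \<in> P \<Longrightarrow> x + y \<in> P"
  using additive_subgroup.a_closed[OF is_additive_subgroup]
  by (simp add: ring_of_type_algebra_def)

lemma prime_ideal_mult_left: "x \<in> P \<Longrightarrow> y * x \<in> P"
  using I_l_closed by (simp add: ring_of_type_algebra_def)

lemma prime_ideal_mult_right: "x \<in> P \<Longrightarrow> x * y \<in> P"
  using I_r_closed by (simp add: ring_of_type_algebra_def)

lemma prime_ideal_mult_iff: "x * y \<in> P \<longleftrightarrow> x \<in> P \<or> y \<in> P"
  using I_prime prime_ideal_mult_left prime_ideal_mult_right
  by (auto simp: ring_of_type_algebra_def)

lemma prime_ideal_sum: "(\<And>i. i \<in> A \<Longrightarrow> F i \<in> P) \<Longrightarrow> sum F A \<in> P"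
  by (induction A rule: infinite_finite_induct) (auto intro: prime_ideal_zero prime_ideal_add)

lemma prime_ideal_add_cancel:
  assumes "x + y \<in> P" "y \<in> P"
  shows "x \<in> P"
  using prime_ideal_add[OF assms(1) prime_ideal_mult_left[OF assms(2), of "- 1"]] by simp

end

lemma prime_ideal_singleton_zero: "prime_ideal {0 :: 'r::idom}"
proof -
  interpret cring "ring_of_type_algebra :: 'r ring"
    by (rule cring_from_type_algebra)
  have "Ring.domain (ring_of_type_algebra :: 'r ring)"
    by unfold_locales (auto simp: ring_of_type_algebra_def)
  from domain.zeroprimeideal[OF this] show ?thesis
    by (simp add: ring_of_type_algebra_def)
qed

section \<open>Extreme exponents of a product\<close>

text \<open>
  The support of the reduction of \<open>f\<close> modulo \<open>P\<close>. For \<open>P = {0}\<close> it is \<open>keys f\<close>.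
\<close>
definition supp_mod :: "'r::idom set \<Rightarrow> ('m \<Rightarrow>\<^sub>0 'r) \<Rightarrow> 'm set" where
  "supp_mod P f = {s. Poly_Mapping.lookup f s \<notin> P}"

lemma supp_mod_zero: "supp_mod {0} f = Poly_Mapping.keys f"
  by (auto simp: supp_mod_def in_keys_iff)

lemma supp_mod_subset_keys: "prime_ideal P \<Longrightarrow> supp_mod P f \<subseteq> Poly_Mapping.keys f"
  using prime_ideal_zero[of P] by (auto simp: supp_mod_def in_keys_iff)

lemma finite_supp_mod: "prime_ideal P \<Longrightarrow> finite (supp_mod P f)"
  by (rule finite_subset[OF supp_mod_subset_keys finite_keys])

lemma lookup_mult_keys:
  "Poly_Mapping.lookup (f * g) k = (\<Sum>(a, b)\<in>Poly_Mapping.keys f \<times> Poly_Mapping.keys g.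
     Poly_Mapping.lookup f a * Poly_Mapping.lookup g b when a + b = k)"
proof -
  have "Poly_Mapping.lookup (f * g) k = (\<Sum>(a, b).
      Poly_Mapping.lookup f a * Poly_Mapping.lookup g b when k = a + b)"
    unfolding times_poly_mapping.rep_eq by (rule prod_fun_unfold_prod) simp_all
  also have "\<dots> = (\<Sum>(a, b)\<in>Poly_Mapping.keys f \<times> Poly_Mapping.keys g.
      Poly_Mapping.lookup f a * Poly_Mapping.lookup g b when k = a + b)"
    by (rule Sum_any.expand_superset) (auto simp: in_keys_iff when_def split: if_splits)
  finally show ?thesis
    by (simp add: eq_commute[of k])
qed

lemma supp_mod_mult_empty:
  assumes P: "prime_ideal P" and "supp_mod P f = {} \<or> supp_mod P g = {}"
  shows "supp_mod P (f * g) = {}"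
proof -
  have "Poly_Mapping.lookup (f * g) k \<in> P" for k
    unfolding lookup_mult_keys using assms(2)
    by (intro prime_ideal_sum[OF P])
       (auto simp: supp_mod_def when_def prime_ideal_zero[OF P] prime_ideal_mult_iff[OF P])
  then show ?thesis
    by (simp add: supp_mod_def)
qed

text \<open>
  Modulo \<open>P\<close>, the coefficient at \<open>s + t\<close> is the single product of the coefficients at \<open>s\<close> and \<open>t\<close>,
  since every other contribution has a factor in \<open>P\<close>; this product is not in \<open>P\<close> because \<open>P\<close> is
  prime.
\<close>
lemma unique_sum_in_supp_mod_mult:
  assumes P: "prime_ideal P" and s: "s \<in> supp_mod P f" and t: "t \<in> supp_mod P g"
    and unique: "\<And>u v. u \<in> supp_mod P f \<Longrightarrow> v \<in> supp_mod P g \<Longrightarrow> u + v = s + t \<Longrightarrow> u = s \<and> v = t"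
  shows "s + t \<in> supp_mod P (f * g)"
proof -
  let ?X = "Poly_Mapping.keys f \<times> Poly_Mapping.keys g"
  let ?F = "\<lambda>(a, b). Poly_Mapping.lookup f a * Poly_Mapping.lookup g b when a + b = s + t"
  have st: "(s, t) \<in> ?X"
    using s t supp_mod_subset_keys[OF P, of f] supp_mod_subset_keys[OF P, of g]
    by auto
  have rest: "sum ?F (?X - {(s, t)}) \<in> P"
    using unique
    by (intro prime_ideal_sum[OF P])
       (auto simp: supp_mod_def when_def prime_ideal_zero[OF P] prime_ideal_mult_iff[OF P]
         split: if_splits)
  have split: "Poly_Mapping.lookup (f * g) (s + t) = ?F (s, t) + sum ?F (?X - {(s, t)})"
    unfolding lookup_mult_keys by (intro sum.remove st) simp
  have main: "?F (s, t) \<notin> P"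
    using s t by (simp add: supp_mod_def prime_ideal_mult_iff[OF P])
  have "Poly_Mapping.lookup (f * g) (s + t) \<notin> P"
  proof
    assume "Poly_Mapping.lookup (f * g) (s + t) \<in> P"
    then have "?F (s, t) \<in> P"
      unfolding split by (rule prime_ideal_add_cancel[OF P _ rest])
    with main show False ..
  qed
  then show ?thesis
    by (simp add: supp_mod_def)
qed

lemma add_eq_add_if_le:
  fixes u v s t :: "'m::totally_ordered_monoid"
  assumes "u \<le> s" "v \<le> t" "u + v = s + t"
  shows "u = s \<and> v = t"
proof -
  have "s + v = s + t"
    using assms by (metis add_left_mono add_right_mono antisym)
  then show ?thesis
    using assms(3) by simp
qed

lemma Max_supp_mod_mult:
  fixes f g :: "'m::totally_ordered_monoid \<Rightarrow>\<^sub>0 'r::idom"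
  assumes P: "prime_ideal P" and "supp_mod P f \<noteq> {}" "supp_mod P g \<noteq> {}"
  shows "Max (supp_mod P f) + Max (supp_mod P g) \<in> supp_mod P (f * g)"
proof (rule unique_sum_in_supp_mod_mult[OF P])
  fix u v
  assume "u \<in> supp_mod P f" "v \<in> supp_mod P g"
    and eq: "u + v = Max (supp_mod P f) + Max (supp_mod P g)"
  then have "u \<le> Max (supp_mod P f)" "v \<le> Max (supp_mod P g)"
    by (simp_all add: finite_supp_mod[OF P])
  then show "u = Max (supp_mod P f) \<and> v = Max (supp_mod P g)"
    using eq by (rule add_eq_add_if_le)
qed (simp_all add: assms finite_supp_mod[OF P])

lemma Min_supp_mod_mult:
  fixes f g :: "'m::totally_ordered_monoid \<Rightarrow>\<^sub>0 'r::idom"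
  assumes P: "prime_ideal P" and "supp_mod P f \<noteq> {}" "supp_mod P g \<noteq> {}"
  shows "Min (supp_mod P f) + Min (supp_mod P g) \<in> supp_mod P (f * g)"
proof (rule unique_sum_in_supp_mod_mult[OF P])
  fix u v
  assume "u \<in> supp_mod P f" "v \<in> supp_mod P g"
    and eq: "u + v = Min (supp_mod P f) + Min (supp_mod P g)"
  then have "Min (supp_mod P f) \<le> u" "Min (supp_mod P g) \<le> v"
    by (simp_all add: finite_supp_mod[OF P])
  then show "u = Min (supp_mod P f) \<and> v = Min (supp_mod P g)"
    using add_eq_add_if_le[OF _ _ eq[symmetric]] by simp
qed (simp_all add: assms finite_supp_mod[OF P])

section \<open>Factors over a reduced monoid\<close>

text \<open>
  The sum of the least exponents of \<open>g\<close> and \<open>h\<close> is an exponent of \<open>g * h\<close>, hence at least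
  \<open>0\<close>. Conversely \<open>0\<close>, as an exponent of \<open>g * h\<close>, is a sum of an exponent of \<open>g\<close> and one of
  \<open>h\<close>, hence at least the sum of the least ones. So the least exponents add up to \<open>0\<close>, and
  reducedness makes both vanish, although the order may allow negative exponents.
\<close>
lemma Min_keys_factors_eq_zero:
  fixes g h :: "'m::totally_ordered_monoid \<Rightarrow>\<^sub>0 'r::idom"
  assumes reduced: "\<forall>x y :: 'm. x + y = 0 \<longrightarrow> x = 0"
    and nonneg: "\<And>s. s \<in> Poly_Mapping.keys (g * h) \<Longrightarrow> 0 \<le> s"
    and zero: "0 \<in> Poly_Mapping.keys (g * h)"
  shows "Poly_Mapping.keys g \<noteq> {}" "Poly_Mapping.keys h \<noteq> {}"
    and "Min (Poly_Mapping.keys g) = 0" "Min (Poly_Mapping.keys h) = 0"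
proof -
  obtain a b where ab: "a \<in> Poly_Mapping.keys g" "b \<in> Poly_Mapping.keys h" "0 = a + b"
    using zero keys_mult[of g h] by blast
  then show ne: "Poly_Mapping.keys g \<noteq> {}" "Poly_Mapping.keys h \<noteq> {}"
    by auto
  let ?a = "Min (Poly_Mapping.keys g)" and ?b = "Min (Poly_Mapping.keys h)"
  have "?a + ?b \<in> Poly_Mapping.keys (g * h)"
    using Min_supp_mod_mult[OF prime_ideal_singleton_zero, of g h] ne
    by (simp add: supp_mod_zero)
  then have "0 \<le> ?a + ?b"
    by (rule nonneg)
  moreover have "?a + ?b \<le> a + b"
    using ab by (intro add_mono) auto
  ultimately have "?a + ?b = 0"
    using ab(3) by simp
  then show "?a = 0" "?b = 0"
    using reduced by (metis add.commute)+
qed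

lemma lookup_mult_zero:
  fixes g h :: "'m::totally_ordered_monoid \<Rightarrow>\<^sub>0 'r::idom"
  assumes "\<And>s. s \<in> Poly_Mapping.keys g \<Longrightarrow> 0 \<le> s" "\<And>s. s \<in> Poly_Mapping.keys h \<Longrightarrow> 0 \<le> s"
  shows "Poly_Mapping.lookup (g * h) 0 = Poly_Mapping.lookup g 0 * Poly_Mapping.lookup h 0"
proof -
  let ?X = "Poly_Mapping.keys g \<times> Poly_Mapping.keys h"
  let ?F = "\<lambda>(a, b). Poly_Mapping.lookup g a * Poly_Mapping.lookup h b when a + b = 0"
  have "a = 0 \<and> b = 0" if "(a, b) \<in> ?X" "a + b = 0" for a b
    using add_eq_add_if_le[of 0 a 0 b] assms that by auto
  then have "sum ?F ?X = sum ?F (?X \<inter> {(0, 0)})"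
    by (intro sum.mono_neutral_right) (force simp: when_def split: if_splits)+
  also have "\<dots> = ?F (0, 0)"
    by (cases "(0, 0) \<in> ?X") (auto simp: in_keys_iff)
  finally show ?thesis
    by (simp add: lookup_mult_keys)
qed

text \<open>
  Modulo \<open>P\<close> the least exponent of \<open>g\<close> is \<open>0\<close>, and the least exponents of \<open>g\<close> and \<open>h\<close> modulo \<open>P\<close>
  must add up to \<open>m\<close>, so \<open>h\<close> contains the exponent \<open>m\<close>. This leaves no positive exponent for \<open>g\<close>,
  because no exponent of the product exceeds \<open>m\<close>.
\<close>
lemma keys_eq_zero_if_constant_coeff_notin:
  fixes g h :: "'m::totally_ordered_monoid \<Rightarrow>\<^sub>0 'r::idom"
  assumes P: "prime_ideal P"
    and monomial: "supp_mod P (g * h) = {m}"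
    and le: "\<And>s. s \<in> Poly_Mapping.keys (g * h) \<Longrightarrow> s \<le> m"
    and nonneg: "\<And>s. s \<in> Poly_Mapping.keys g \<Longrightarrow> 0 \<le> s"
    and notin: "Poly_Mapping.lookup g 0 \<notin> P"
  shows "Poly_Mapping.keys g = {0}"
proof -
  have zero: "0 \<in> supp_mod P g"
    using notin by (simp add: supp_mod_def)
  have ne: "supp_mod P g \<noteq> {}" "supp_mod P h \<noteq> {}"
    using supp_mod_mult_empty[OF P, of g h] monomial by auto
  have "Min (supp_mod P g) = 0"
    using zero nonneg supp_mod_subset_keys[OF P, of g]
    by (intro Min_eqI finite_supp_mod[OF P]) auto
  then have "m = Min (supp_mod P h)"
    using Min_supp_mod_mult[OF P ne] monomial by simp
  then have m: "m \<in> Poly_Mapping.keys h"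
    using Min_in[OF finite_supp_mod[OF P] ne(2)] supp_mod_subset_keys[OF P, of h] by auto
  let ?a = "Max (Poly_Mapping.keys g)" and ?b = "Max (Poly_Mapping.keys h)"
  have zero': "0 \<in> Poly_Mapping.keys g"
    using zero supp_mod_subset_keys[OF P, of g] by blast
  have "?a + ?b \<in> Poly_Mapping.keys (g * h)"
    using Max_supp_mod_mult[OF prime_ideal_singleton_zero, of g h] m zero'
    unfolding supp_mod_zero by blast
  then have "?a + ?b \<le> 0 + m"
    using le by simp
  moreover have "0 \<le> ?a" "m \<le> ?b"
    using zero' m by auto
  ultimately have "?a = 0"
    using add_eq_add_if_le[of 0 ?a m ?b] add_mono[of 0 ?a m ?b] by (metis antisym)
  then have "s = 0" if "s \<in> Poly_Mapping.keys g" for s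
    using nonneg[OF that] Max_ge[OF finite_keys that] by simp
  then show ?thesis
    using zero' by blast
qed

text \<open>
  The greatest exponents of \<open>f\<close> and of its inverse add up to the only exponent \<open>0\<close> of \<open>1\<close>, and so
  do the least ones; as \<open>M\<close> is reduced, all of them are \<open>0\<close>.
\<close>
lemma keys_unit_eq_zero:
  fixes f :: "'m::totally_ordered_monoid \<Rightarrow>\<^sub>0 'r::idom"
  assumes reduced: "\<forall>x y :: 'm. x + y = 0 \<longrightarrow> x = 0" and unit: "f dvd 1"
  shows "Poly_Mapping.keys f = {0}"
proof -
  obtain g where g: "f * g = 1"
    using unit by (metis dvdE)
  then have keys: "Poly_Mapping.keys (f * g) = {0}"
    by simp
  have min: "Min (Poly_Mapping.keys f) = 0"
    and ne: "Poly_Mapping.keys f \<noteq> {}" "Poly_Mapping.keys g \<noteq> {}"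
    using Min_keys_factors_eq_zero[of f g, OF reduced] keys by auto
  have "Max (Poly_Mapping.keys f) + Max (Poly_Mapping.keys g) = 0"
    using Max_supp_mod_mult[OF prime_ideal_singleton_zero, of f g] ne keys
    by (simp add: supp_mod_zero)
  then have "Max (Poly_Mapping.keys f) = 0"
    using reduced by blast
  then have "s = 0" if "s \<in> Poly_Mapping.keys f" for s
    using min Min_le[OF finite_keys that] Max_ge[OF finite_keys that] by simp
  then show ?thesis
    using ne by blast
qed

lemma constant_dvd_primitive_imp_unit:
  fixes g h :: "'m::totally_ordered_monoid \<Rightarrow>\<^sub>0 'r::idom"
  assumes prim: "primitive (g * h)" and const: "Poly_Mapping.keys g = {0}"
  shows "g dvd 1"
proof -
  define c where "c = Poly_Mapping.lookup g 0"
  have g: "g = Poly_Mapping.single 0 c"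
  proof (rule poly_mapping_eqI)
    show "Poly_Mapping.lookup g k = Poly_Mapping.lookup (Poly_Mapping.single 0 c) k" for k
      using const not_in_keys_iff_lookup_eq_zero[of k g]
      by (cases "k = 0") (simp_all add: c_def lookup_single)
  qed
  have "c dvd Poly_Mapping.lookup (g * h) s" for s
    unfolding lookup_mult_keys
    by (rule dvd_sum) (auto simp: g lookup_single when_def)
  moreover have "1 \<in> content (g * h)"
    using prim by (simp add: primitive_def)
  ultimately have "c dvd 1"
    by (auto simp: content_def gcds_def)
  then obtain d where "1 = c * d" ..
  then have "g * Poly_Mapping.single 0 d = 1"
    by (simp add: g mult_single flip: single_one)
  then show ?thesis
    by (metis dvdI)
qed

section \<open>Eisenstein's criterion\<close>

theorem proposition3p4:
  fixes f :: "'m::totally_ordered_monoid \<Rightarrow>\<^sub>0 'r::idom"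
    and \<alpha> :: "nat \<Rightarrow> 'r" and q :: "nat \<Rightarrow> 'm" and n :: nat
  assumes reduced: "\<forall>x y :: 'm. x + y = 0 \<longrightarrow> x = 0"
    and torsion_free: "\<forall>(k::nat) (x::'m) y. k \<ge> 1 \<longrightarrow> (\<Sum>i<k. x) = (\<Sum>i<k. y) \<longrightarrow> x = y"
    and n: "n \<ge> 1"
    and f_nonzero: "f \<noteq> 0"
    and f: "f = (\<Sum>j=1..n. Poly_Mapping.single (q j) (\<alpha> j)) + Poly_Mapping.single 0 (\<alpha> 0)"
    and coeffs_nonzero: "\<forall>j\<le>n. \<alpha> j \<noteq> 0"
    and exponents: "0 < q 1" "strict_mono_on {1..n} q"
    and prim: "primitive f"
    and eisenstein: "\<exists>P. primeideal P (ring_of_type_algebra :: 'r ring)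
      \<and> \<alpha> n \<notin> P
      \<and> (\<forall>j<n. \<alpha> j \<in> P)
      \<and> \<alpha> 0 \<notin> ideal_prod (ring_of_type_algebra :: 'r ring) P P"
  shows "Factorial_Ring.irreducible f"
proof -
  obtain P where P: "prime_ideal P" and lead: "\<alpha> n \<notin> P" and lower: "\<And>j. j < n \<Longrightarrow> \<alpha> j \<in> P"
    and const: "\<alpha> 0 \<notin> ideal_prod (ring_of_type_algebra :: 'r ring) P P"
    using eisenstein by blast
  have q_pos: "0 < q j" if "1 \<le> j" "j \<le> n" for j
    using exponents that strict_mono_onD[OF exponents(2), of 1 j]
    by (cases "j = 1") (auto intro: less_trans)
  have q_less: "q j < q n" if "1 \<le> j" "j < n" for j
    using strict_mono_onD[OF exponents(2), of j n] that by auto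
  have lookup: "Poly_Mapping.lookup f s =
      (\<Sum>j=1..n. \<alpha> j when q j = s) + (\<alpha> 0 when 0 = s)" for s
    by (simp add: f lookup_add lookup_sum lookup_single)
  have "(\<Sum>j=1..n. \<alpha> j when q j = 0) = 0"
    using q_pos by (intro sum.neutral) (fastforce simp: when_def)
  then have f_zero: "Poly_Mapping.lookup f 0 = \<alpha> 0"
    by (simp add: lookup)
  have f_top: "Poly_Mapping.lookup f (q n) = \<alpha> n"
  proof -
    have "(\<Sum>j=1..n. \<alpha> j when q j = q n) = (\<Sum>j\<in>{n}. \<alpha> j when q j = q n)"
    proof (intro sum.mono_neutral_right ballI)
      fix j assume "j \<in> {1..n} - {n}"
      then have "q j < q n"
        by (intro q_less) auto
      then show "(\<alpha> j when q j = q n) = 0"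
        by simp
    qed (use n in auto)
    then show ?thesis
      using q_pos[of n] n by (simp add: lookup when_def)
  qed
  have keys: "0 \<le> s \<and> s \<le> q n" if s: "s \<in> Poly_Mapping.keys f" for s
  proof -
    have "s = 0 \<or> (\<exists>j\<in>{1..n}. q j = s)"
    proof (rule ccontr)
      assume "\<not> ?thesis"
      then have "Poly_Mapping.lookup f s = 0"
        by (auto simp: lookup when_def intro!: sum.neutral)
      with s show False
        by (simp add: in_keys_iff)
    qed
    then show ?thesis
    proof
      assume "s = 0"
      then show ?thesis
        using q_pos[of n] n by simp
    next
      assume "\<exists>j\<in>{1..n}. q j = s"
      then obtain j where "1 \<le> j" "j \<le> n" "s = q j"
        by auto
      then show ?thesis
        using q_pos[of j] q_less[of j] by (cases "j = n") auto
    qed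
  qed
  have mod_P: "supp_mod P f = {q n}"
  proof -
    have "Poly_Mapping.lookup f s \<in> P" if "s \<noteq> q n" for s
      unfolding lookup using that n lower prime_ideal_zero[OF P]
      by (intro prime_ideal_add[OF P] prime_ideal_sum[OF P])
         (auto simp: when_def le_less)
    then show ?thesis
      using f_top lead by (auto simp: supp_mod_def)
  qed
  have zero_key: "0 \<in> Poly_Mapping.keys f"
    using f_zero coeffs_nonzero by (simp add: in_keys_iff)
  have top_key: "q n \<in> Poly_Mapping.keys f"
    using f_top coeffs_nonzero by (simp add: in_keys_iff)

  \<comment> \<open>The two factors enter symmetrically, up to the choice of the one with constant coefficient
      outside \<open>P\<close>.\<close>
  have unit: "g dvd 1"
    if gh: "f = g * h" and "Poly_Mapping.lookup g 0 \<notin> P" for g h :: "'m \<Rightarrow>\<^sub>0 'r"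
  proof -
    have "Min (Poly_Mapping.keys g) = 0"
      using Min_keys_factors_eq_zero[of g h, OF reduced] keys zero_key gh by blast
    then have "0 \<le> s" if "s \<in> Poly_Mapping.keys g" for s
      using Min_le[OF finite_keys that] by simp
    then have "Poly_Mapping.keys g = {0}"
      using keys_eq_zero_if_constant_coeff_notin[OF P, of g h "q n"] mod_P keys gh that(2) by blast
    then show ?thesis
      using constant_dvd_primitive_imp_unit[of g h] prim gh by blast
  qed
  show ?thesis
  proof (rule irreducibleI)
    show "f \<noteq> 0"
      by (rule f_nonzero)
    show "\<not> f dvd 1"
      using keys_unit_eq_zero[OF reduced] top_key q_pos[of n] n by fastforce
    fix g h :: "'m \<Rightarrow>\<^sub>0 'r"
    assume gh: "f = g * h"
    have "Min (Poly_Mapping.keys g) = 0" "Min (Poly_Mapping.keys h) = 0"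
      using Min_keys_factors_eq_zero[of g h, OF reduced] keys zero_key gh by blast+
    then have "0 \<le> s" if "s \<in> Poly_Mapping.keys g \<or> s \<in> Poly_Mapping.keys h" for s
      using that Min_le[OF finite_keys, of s g] Min_le[OF finite_keys, of s h] by auto
    then have prod: "\<alpha> 0 = Poly_Mapping.lookup g 0 * Poly_Mapping.lookup h 0"
      using lookup_mult_zero[of g h] f_zero gh by simp
    have "Poly_Mapping.lookup g 0 \<notin> P \<or> Poly_Mapping.lookup h 0 \<notin> P"
    proof (rule ccontr)
      assume "\<not> ?thesis"
      then have "\<alpha> 0 \<in> ideal_prod (ring_of_type_algebra :: 'r ring) P P"
        using ideal_prod.prod[of "Poly_Mapping.lookup g 0" P "Poly_Mapping.lookup h 0" P
            "ring_of_type_algebra :: 'r ring"]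
        by (simp add: prod ring_of_type_algebra_def)
      with const show False ..
    qed
    then show "g dvd 1 \<or> h dvd 1"
      using unit[of g h] unit[of h g] gh by (auto simp: mult.commute)
  qed
qed

end
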